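(* Let $n\geq 1$ be a natural number, let $I\subset\mathbb{R}$ be an interval, let $f:I\to\mathbb{R}$ be $n$-times differentiable, and let $a,b\in I$ with $a<b$. Let $q\geq 1$ be a real number. If $f^{(n)}\in L[a,b]$ and $|f^{(n)}|^q$ is convex on $[a,b]$, then $$\left|\int_a^b f(t)\,dt-\sum_{k=0}^{n-1}\left(\frac{1+(-1)^k}{2^{k+1}(k+1)!}\right)(b-a)^{k+1}f^{(k)}\left(\frac{a+b}{2}\right)\right|$$ $$\leq \frac{(b-a)^{n+1}}{2^{n+1}(n+1)!}\left\{\left[\frac{n+1}{2n+4}|f^{(n)}(a)|^q+\frac{n+3}{2n+4}|f^{(n)}(b)|^q\right]^{\frac1q}+\left[\frac{n+3}{2n+4}|f^{(n)}(a)|^q+\frac{n+1}{2n+4}|f^{(n)}(b)|^q\right]^{\frac1q}\right\}.$$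
   Context: $f^{(k)}$ denotes the $k$-th derivative of $f$, with $f^{(0)}=f$; $L[a,b]$ denotes the space of (Lebesgue) integrable functions on $[a,b]$. A function $g:[a,b]\to\mathbb{R}$ is convex if $g(tx+(1-t)y)\leq t g(x)+(1-t)g(y)$ for all $x,y\in[a,b]$ and $t\in[0,1]$. *)

theory Defs
  imports "HOL-Analysis.Analysis"
begin

text \<open>Derivatives are taken relative to the domain \<open>I\<close>, hence are one-sided at an endpoint of
  \<open>I\<close> that belongs to \<open>I\<close>, and do not depend on the values of \<open>f\<close> outside \<open>I\<close>.\<close>

primrec nth_deriv_on :: "real set \<Rightarrow> nat \<Rightarrow> (real \<Rightarrow> real) \<Rightarrow> real \<Rightarrow> real" where
  "nth_deriv_on I 0 f = f"
| "nth_deriv_on I (Suc k) f = (\<lambda>x. vector_derivative (nth_deriv_on I k f) (at x within I))"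

definition n_times_differentiable_on :: "nat \<Rightarrow> (real \<Rightarrow> real) \<Rightarrow> real set \<Rightarrow> bool" where
  "n_times_differentiable_on n f I \<longleftrightarrow> (\<forall>k<n. nth_deriv_on I k f differentiable_on I)"

text \<open>On an interval with at least two points the derivative is unique, so these definitions agree
  with any chain of functions \<open>D 0 = f, D 1, \<dots>, D n\<close> in which each is the derivative of the
  previous one.\<close>

lemma nth_deriv_on_has_real_derivative:
  assumes "n_times_differentiable_on n f I" "k < n" "x \<in> I"
  shows "(nth_deriv_on I k f has_real_derivative nth_deriv_on I (Suc k) f x) (at x within I)"
  using assms
  by (auto simp: n_times_differentiable_on_def differentiable_on_def vector_derivative_works
      has_real_derivative_iff_has_vector_derivative)

lemma nth_deriv_on_unique:
  fixes D :: "nat \<Rightarrow> real \<Rightarrow> real"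
  assumes I: "is_interval I" "u \<in> I" "v \<in> I" "u < v"
    and D0: "\<And>x. x \<in> I \<Longrightarrow> D 0 x = f x"
    and D: "\<And>k x. k < n \<Longrightarrow> x \<in> I \<Longrightarrow> (D k has_real_derivative D (Suc k) x) (at x within I)"
  shows "n_times_differentiable_on n f I"
    and "\<And>k x. k \<le> n \<Longrightarrow> x \<in> I \<Longrightarrow> nth_deriv_on I k f x = D k x"
proof -
  have nontriv: "at x within I \<noteq> bot" if "x \<in> I" for x
  proof -
    have "connected I" using I(1) by (simp add: is_interval_connected)
    moreover have "\<not> (\<exists>a. I = {a})" using I(2-4) by force
    ultimately show ?thesis
      using connected_imp_perfect[of I x] that by (simp add: trivial_limit_within)
  qed
  have *: "\<forall>x\<in>I. nth_deriv_on I k f x = D k x" if "k \<le> n" for k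
    using that
  proof (induction k)
    case 0
    then show ?case by (simp add: D0)
  next
    case (Suc k)
    show ?case
    proof
      fix x assume x: "x \<in> I"
      have "(D k has_vector_derivative D (Suc k) x) (at x within I)"
        using D[of k x] Suc.prems x by (simp add: has_real_derivative_iff_has_vector_derivative)
      then have "(nth_deriv_on I k f has_vector_derivative D (Suc k) x) (at x within I)"
        by (rule has_vector_derivative_transform[rotated 2]) (use Suc x in auto)
      then show "nth_deriv_on I (Suc k) f x = D (Suc k) x"
        using vector_derivative_within[OF nontriv[OF x]] by simp
    qed
  qed
  then show "\<And>k x. k \<le> n \<Longrightarrow> x \<in> I \<Longrightarrow> nth_deriv_on I k f x = D k x" by blast
  have "nth_deriv_on I k f differentiable (at x within I)" if "k < n" "x \<in> I" for k x
  proof -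
    have "(nth_deriv_on I k f has_real_derivative D (Suc k) x) (at x within I)"
      using D[OF that] by (rule has_field_derivative_transform_within[where d = 1])
        (use * that in auto)
    then show ?thesis
      by (meson has_field_derivative_def differentiable_def)
  qed
  then show "n_times_differentiable_on n f I"
    by (simp add: n_times_differentiable_on_def differentiable_on_def)
qed

end

theory Submission
  imports Defs
begin

text \<open>Taylor's formula with integral remainder for an antiderivative of \<open>f\<close>, expanded about the
  midpoint, on each half of the interval: adding the two halves cancels the terms with odd \<open>k\<close>.
  Convexity bounds \<open>\<bar>f\<^sup>(\<^sup>n\<^sup>)\<bar>\<^sup>q\<close> by an affine function \<open>u\<close>, and the power mean inequality reduces to the
  pointwise tangent bound for the concave function \<open>u \<mapsto> u powr (1 / q)\<close> at the mean \<open>u0\<close> of \<open>u\<close> against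
  the Taylor kernel, so that only polynomials have to be integrated.\<close>

text \<open>Writing t - c = (d - c) - (d - t) leaves only powers of d - t to integrate. The result
  exhibits (d - c) / (n + 2) as the mean of t - c against the kernel.\<close>

lemma has_integral_taylor_kernel_affine:
  fixes c d A B :: real
  assumes "c \<le> d"
  shows "((\<lambda>t. (d - t) ^ n / fact n * (A + B * (t - c))) has_integral
    (d - c) ^ (n + 1) / fact (n + 1) * (A + B * (d - c) / (real n + 2))) {c..d}"
proof -
  have pow: "((\<lambda>t. (d - t) ^ k) has_integral (d - c) ^ (k + 1) / (real k + 1)) {c..d}" for k
  proof -
    have "((\<lambda>t. - ((d - t) ^ (k + 1)) / (real k + 1)) has_real_derivative (d - t) ^ k)
        (at t within {c..d})" for t
      by (rule derivative_eq_intros refl | simp)+ (simp add: divide_simps)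
    then have "((\<lambda>t. (d - t) ^ k) has_integral
        - ((d - d) ^ (k + 1)) / (real k + 1) - - ((d - c) ^ (k + 1)) / (real k + 1)) {c..d}"
      by (intro fundamental_theorem_of_calculus assms)
        (simp add: has_real_derivative_iff_has_vector_derivative)
    then show ?thesis by simp
  qed
  let ?h = "d - c"
  have "((\<lambda>t. (A + B * ?h) / fact n * (d - t) ^ n - B / fact n * (d - t) ^ (n + 1)) has_integral
      (A + B * ?h) / fact n * (?h ^ (n + 1) / (real n + 1))
      - B / fact n * (?h ^ (n + 1 + 1) / (real (n + 1) + 1))) {c..d}"
    by (intro has_integral_diff has_integral_mult_right pow)
  moreover have "(A + B * ?h) / fact n * (d - t) ^ n - B / fact n * (d - t) ^ (n + 1)
      = (d - t) ^ n / fact n * (A + B * (t - c))" for t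
    by (simp add: divide_simps) (simp add: algebra_simps)
  moreover have "(A + B * ?h) / fact n * (?h ^ (n + 1) / (real n + 1))
      - B / fact n * (?h ^ (n + 1 + 1) / (real (n + 1) + 1))
      = ?h ^ (n + 1) / fact (n + 1) * (A + B * ?h / (real n + 2))"
  proof -
    \<comment> \<open>With the factorial and the power replaced by variables, this is a plain
      rational identity.\<close>
    have *: "(A + B * ?h) / F * (P / (N + 1)) - B / F * (?h * P / (N + 2))
        = P / ((N + 1) * F) * (A + B * ?h / (N + 2))" if "F > 0" "N \<ge> 0" for F N P :: real
      using that by (simp add: divide_simps) algebra
    show ?thesis
      using *[of "fact n" "real n" "?h ^ (n + 1)"] by (simp add: add.commute mult.assoc)
  qed
  ultimately show ?thesis by simp
qed

lemma integral_taylor_error_le_affine: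
  fixes D :: "nat \<Rightarrow> real \<Rightarrow> real"
  assumes "n \<ge> 1" "c \<le> d"
    and D: "\<And>k t. k < n \<Longrightarrow> t \<in> {c..d} \<Longrightarrow>
      (D k has_real_derivative D (Suc k) t) (at t within {c..d})"
    and le: "\<And>t. t \<in> {c..d} \<Longrightarrow> \<bar>D n t\<bar> \<le> A + B * (t - c)"
  shows "\<bar>integral {c..d} (D 0) - (\<Sum>k<n. (d - c) ^ (k + 1) / fact (k + 1) * D k c)\<bar>
    \<le> (d - c) ^ (n + 1) / fact (n + 1) * (A + B * (d - c) / (real n + 2))"
proof -
  \<comment> \<open>Prepending the antiderivative shifts the chain by one, so Taylor's formula is
    used with order \<open>Suc n\<close>. The zeroth term \<open>F 0 c\<close> is an integral over a
    single point and drops out.\<close>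
  define F where "F = case_nat (\<lambda>x. integral {c..x} (D 0)) D"
  have cont: "continuous_on {c..d} (D 0)"
    using D[of 0] \<open>n \<ge> 1\<close> by (intro DERIV_continuous_on[of _ _ "D (Suc 0)"]) auto
  have F: "(F k has_vector_derivative F (Suc k) t) (at t within {c..d})"
    if "k < Suc n" "c \<le> t" "t \<le> d" for k t
    using that D integral_has_vector_derivative[OF cont, of t]
    by (cases k) (auto simp: F_def has_real_derivative_iff_has_vector_derivative)
  have "((\<lambda>t. ((d - t) ^ (Suc n - 1) / fact (Suc n - 1)) *\<^sub>R F (Suc n) t) has_integral
    F 0 d - (\<Sum>k<Suc n. ((d - c) ^ k / fact k) *\<^sub>R F k c)) {c..d}"
    by (rule Taylor_has_integral[where f = "F 0"]) (use F \<open>c \<le> d\<close> in auto)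
  moreover have "(\<Sum>k<Suc n. ((d - c) ^ k / fact k) *\<^sub>R F k c)
      = (\<Sum>k<n. (d - c) ^ (k + 1) / fact (k + 1) * D k c)"
    by (subst sum.lessThan_Suc_shift) (simp add: F_def)
  ultimately have rem: "((\<lambda>t. (d - t) ^ n / fact n * D n t) has_integral
      integral {c..d} (D 0) - (\<Sum>k<n. (d - c) ^ (k + 1) / fact (k + 1) * D k c)) {c..d}"
    by (simp add: F_def)
  have "norm ((d - t) ^ n / fact n * D n t) \<le> (d - t) ^ n / fact n * (A + B * (t - c))"
    if "t \<in> {c..d}" for t
    using le[OF that] that by (simp add: abs_mult divide_right_mono mult_left_mono)
  \<comment> \<open>The integrability of the left integrand is supplied by Taylor's formula itself,
    through \<open>rem\<close>.\<close>
  then have "norm (integral {c..d} (\<lambda>t. (d - t) ^ n / fact n * D n t))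
      \<le> integral {c..d} (\<lambda>t. (d - t) ^ n / fact n * (A + B * (t - c)))"
    using rem has_integral_taylor_kernel_affine[OF \<open>c \<le> d\<close>]
    by (intro Henstock_Kurzweil_Integration.integral_norm_bound_integral)
      (blast intro: has_integral_integrable)+
  then show ?thesis
    unfolding integral_unique[OF rem] real_norm_def
      integral_unique[OF has_integral_taylor_kernel_affine[OF \<open>c \<le> d\<close>]] .
qed

text \<open>Young's inequality with weights p and 1 - p, divided by \<open>u0 powr (1 - p)\<close>.
  The right side is the tangent at u0 to u powr p.\<close>

lemma powr_le_tangent:
  fixes u u0 p :: real
  assumes "u \<ge> 0" "u0 > 0" "0 < p" "p \<le> 1"
  shows "u powr p \<le> u0 powr (p - 1) * (p * u + (1 - p) * u0)"
proof (cases "u = 0")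
  case False
  then have "u powr p * u0 powr (1 - p) \<le> p * u + (1 - p) * u0"
    using assms by (intro Youngs_inequality_0) auto
  then have "u0 powr (p - 1) * (u powr p * u0 powr (1 - p))
      \<le> u0 powr (p - 1) * (p * u + (1 - p) * u0)"
    by (intro mult_left_mono) auto
  moreover have "u0 powr (p - 1) * u0 powr (1 - p) = 1"
    using \<open>u0 > 0\<close> by (simp flip: powr_add)
  ultimately show ?thesis by (simp add: mult.left_commute)
qed (use assms in simp)

text \<open>The tangent at u0 is affine, so the previous estimate applies to it. Averaging an affine
  function against the kernel evaluates it at the mean, where the tangent touches the curve.\<close>

lemma integral_taylor_error_le_powr:
  fixes D :: "nat \<Rightarrow> real \<Rightarrow> real"
  assumes "n \<ge> 1" "c < d" "q \<ge> 1"
    and D: "\<And>k t. k < n \<Longrightarrow> t \<in> {c..d} \<Longrightarrow>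
      (D k has_real_derivative D (Suc k) t) (at t within {c..d})"
    and le: "\<And>t. t \<in> {c..d} \<Longrightarrow> \<bar>D n t\<bar> powr q \<le> \<alpha> + \<beta> * (t - c)"
  shows "\<bar>integral {c..d} (D 0) - (\<Sum>k<n. (d - c) ^ (k + 1) / fact (k + 1) * D k c)\<bar>
    \<le> (d - c) ^ (n + 1) / fact (n + 1) * (\<alpha> + \<beta> * (d - c) / (real n + 2)) powr (1 / q)"
proof -
  define u0 where "u0 = \<alpha> + \<beta> * (d - c) / (real n + 2)"
  have \<alpha>: "\<alpha> \<ge> 0" and \<alpha>\<beta>: "\<alpha> + \<beta> * (d - c) \<ge> 0"
    using order_trans[OF powr_ge_zero le[of c]] order_trans[OF powr_ge_zero le[of d]] \<open>c < d\<close>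
    by auto
  \<comment> \<open>A convex combination of the two endpoint values with positive weights: u0 is
    nonnegative, and it vanishes only if both values do.\<close>
  have u0: "u0 = (real n + 1) / (real n + 2) * \<alpha> + 1 / (real n + 2) * (\<alpha> + \<beta> * (d - c))"
    by (simp add: u0_def divide_simps) (simp add: algebra_simps)
  have bound: "\<bar>D n t\<bar> \<le> (\<alpha> + \<beta> * (t - c)) powr (1 / q)" if "t \<in> {c..d}" for t
    using powr_mono2[OF _ _ le[OF that], of "1 / q"] \<open>q \<ge> 1\<close> by (simp add: powr_powr)
  show ?thesis
  proof (cases "u0 = 0")
    \<comment> \<open>There is no tangent at 0 to use here, but the affine bound vanishes
      identically, and hence so does \<open>D n\<close> on the interval.\<close>
    case True
    have "(real n + 1) / (real n + 2) * \<alpha> \<ge> 0" "1 / (real n + 2) * (\<alpha> + \<beta> * (d - c)) \<ge> 0"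
      using \<alpha> \<alpha>\<beta> by auto
    with True u0 have "(real n + 1) / (real n + 2) * \<alpha> = 0"
      "1 / (real n + 2) * (\<alpha> + \<beta> * (d - c)) = 0" by linarith+
    then have "\<alpha> = 0" "\<beta> = 0"
      using \<open>c < d\<close> by (auto simp: add_eq_0_iff)
    then show ?thesis
      using integral_taylor_error_le_affine[of n c d D 0 0] bound D assms(1,2) by simp
  next
    case False
    moreover have "u0 \<ge> 0" unfolding u0 using \<alpha> \<alpha>\<beta> by simp
    ultimately have "u0 > 0" by simp
    define A where "A = u0 powr (1 / q - 1) * (1 / q * \<alpha> + (1 - 1 / q) * u0)"
    define B where "B = u0 powr (1 / q - 1) * (1 / q * \<beta>)"
    have "\<bar>D n t\<bar> \<le> A + B * (t - c)" if "t \<in> {c..d}" for t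
    proof -
      have "\<bar>D n t\<bar> \<le> (\<alpha> + \<beta> * (t - c)) powr (1 / q)" by (rule bound[OF that])
      also have "\<dots> \<le> u0 powr (1 / q - 1) * (1 / q * (\<alpha> + \<beta> * (t - c)) + (1 - 1 / q) * u0)"
        using order_trans[OF powr_ge_zero le[OF that]] \<open>u0 > 0\<close> \<open>q \<ge> 1\<close>
        by (intro powr_le_tangent) auto
      also have "\<dots> = A + B * (t - c)"
        by (simp add: A_def B_def algebra_simps add_divide_distrib diff_divide_distrib)
      finally show ?thesis .
    qed
    from integral_taylor_error_le_affine[OF \<open>n \<ge> 1\<close> less_imp_le[OF \<open>c < d\<close>] D this]
    have "\<bar>integral {c..d} (D 0) - (\<Sum>k<n. (d - c) ^ (k + 1) / fact (k + 1) * D k c)\<bar>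
      \<le> (d - c) ^ (n + 1) / fact (n + 1) * (A + B * (d - c) / (real n + 2))" .
    moreover have "A + B * (d - c) / (real n + 2) = u0 powr (1 / q)"
    proof -
      have "A + B * (d - c) / (real n + 2)
          = u0 powr (1 / q - 1) * (1 / q * (\<alpha> + \<beta> * (d - c) / (real n + 2)) + (1 - 1 / q) * u0)"
        by (simp add: A_def B_def algebra_simps add_divide_distrib diff_divide_distrib)
      also have "\<dots> = u0 powr (1 / q - 1) * u0"
        unfolding u0_def[symmetric] by (simp add: algebra_simps)
      also have "\<dots> = u0 powr (1 / q)"
        using \<open>u0 > 0\<close> by (simp add: powr_diff)
      finally show ?thesis .
    qed
    ultimately show ?thesis unfolding u0_def by simp
  qed
qed

theorem theorem3:
  fixes f :: "real \<Rightarrow> real" and I :: "real set" and a b q :: real and n :: nat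
  assumes "n \<ge> 1"
    and "is_interval I"
    and "n_times_differentiable_on n f I"
    and "a \<in> I" and "b \<in> I" and "a < b"
    and "q \<ge> 1"
    and "nth_deriv_on I n f absolutely_integrable_on {a..b}"
    and "convex_on {a..b} (\<lambda>x. \<bar>nth_deriv_on I n f x\<bar> powr q)"
  shows "\<bar>integral {a..b} f
      - (\<Sum>k<n. (1 + (-1) ^ k) / (2 ^ (k + 1) * fact (k + 1)) * (b - a) ^ (k + 1)
                * nth_deriv_on I k f ((a + b) / 2))\<bar>
    \<le> (b - a) ^ (n + 1) / (2 ^ (n + 1) * fact (n + 1))
      * (((real n + 1) / (2 * real n + 4) * \<bar>nth_deriv_on I n f a\<bar> powr q
          + (real n + 3) / (2 * real n + 4) * \<bar>nth_deriv_on I n f b\<bar> powr q) powr (1 / q)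
       + ((real n + 3) / (2 * real n + 4) * \<bar>nth_deriv_on I n f a\<bar> powr q
          + (real n + 1) / (2 * real n + 4) * \<bar>nth_deriv_on I n f b\<bar> powr q) powr (1 / q))"
proof -
  define D where "D k = nth_deriv_on I k f" for k
  define m where "m = (a + b) / 2"
  define h where "h = (b - a) / 2"
  define \<gamma> where "\<gamma> x = \<bar>D n x\<bar> powr q" for x
  \<comment> \<open>The chord of \<gamma> over [a, b], centred at the midpoint: \<alpha> is its
    value there and \<beta> its slope.\<close>
  define \<alpha> where "\<alpha> = (\<gamma> a + \<gamma> b) / 2"
  define \<beta> where "\<beta> = (\<gamma> b - \<gamma> a) / (b - a)"
  have am: "a < m" and mb: "m < b" and h: "b - m = h" "m - a = h" "b - a = 2 * h" "h > 0"
    using \<open>a < b\<close> by (auto simp: m_def h_def field_simps)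
  have "{a..b} \<subseteq> I"
    using \<open>is_interval I\<close> \<open>a \<in> I\<close> \<open>b \<in> I\<close> by (meson atLeastAtMost_iff mem_is_interval_1_I subsetI)
  then have deriv: "(D k has_real_derivative D (Suc k) t) (at t within {a..b})"
    if "k < n" "t \<in> {a..b}" for k t
    unfolding D_def using nth_deriv_on_has_real_derivative[OF assms(3) that(1)] that(2)
    by (blast intro: has_field_derivative_subset)
  have convex: "\<gamma> t \<le> \<alpha> + \<beta> * (t - m)" if "t \<in> {a..b}" for t
  proof -
    have "\<gamma> t \<le> (\<gamma> b - \<gamma> a) / (b - a) * (t - a) + \<gamma> a"
      using convex_onD_Icc'[OF assms(9) that] by (simp add: \<gamma>_def D_def)
    also have "\<dots> = \<alpha> + \<beta> * (t - m)"
      using \<open>a < b\<close> by (simp add: \<alpha>_def \<beta>_def m_def divide_simps) (simp add: algebra_simps)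
    finally show ?thesis .
  qed

  have right: "\<bar>integral {m..b} (D 0) - (\<Sum>k<n. h ^ (k + 1) / fact (k + 1) * D k m)\<bar>
      \<le> h ^ (n + 1) / fact (n + 1) * (\<alpha> + \<beta> * h / (real n + 2)) powr (1 / q)"
    unfolding h(1)[symmetric]
  proof (rule integral_taylor_error_le_powr[OF \<open>n \<ge> 1\<close> mb \<open>q \<ge> 1\<close>])
    show "(D k has_real_derivative D (Suc k) t) (at t within {m..b})"
      if "k < n" "t \<in> {m..b}" for k t
      using that am by (intro has_field_derivative_subset[OF deriv]) auto
    show "\<bar>D n t\<bar> powr q \<le> \<alpha> + \<beta> * (t - m)" if "t \<in> {m..b}" for t
      using convex[of t] that am by (simp add: \<gamma>_def)
  qed

  \<comment> \<open>Reflection makes m the left endpoint, as the one-sided estimate requires. The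
    chain rule contributes the sign (-1)^k, and the slope \<beta> changes sign.\<close>
  define E where "E k s = (-1) ^ k * D k (- s)" for k s
  have E0: "E 0 = (\<lambda>s. D 0 (- s))" by (simp add: E_def fun_eq_iff)
  have "\<bar>integral {- m..- a} (E 0) - (\<Sum>k<n. (- a - - m) ^ (k + 1) / fact (k + 1) * E k (- m))\<bar>
      \<le> (- a - - m) ^ (n + 1) / fact (n + 1)
        * (\<alpha> + (- \<beta>) * (- a - - m) / (real n + 2)) powr (1 / q)"
  proof (rule integral_taylor_error_le_powr[OF \<open>n \<ge> 1\<close> _ \<open>q \<ge> 1\<close>])
    show "(E k has_real_derivative E (Suc k) t) (at t within {- m..- a})"
      if "k < n" "t \<in> {- m..- a}" for k t
    proof -
      have "(D k has_real_derivative D (Suc k) (- t)) (at (- t) within uminus ` {- m..- a})"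
        using that mb by (intro has_field_derivative_subset[OF deriv]) auto
      from DERIV_image_chain[OF this DERIV_minus[OF DERIV_ident]] have
        "((\<lambda>s. D k (- s)) has_real_derivative - D (Suc k) (- t)) (at t within {- m..- a})"
        by (simp add: o_def)
      from DERIV_cmult[OF this, of "(-1) ^ k"] show ?thesis
        by (simp add: E_def[abs_def])
    qed
    show "\<bar>E n t\<bar> powr q \<le> \<alpha> + (- \<beta>) * (t - - m)" if "t \<in> {- m..- a}" for t
      using convex[of "- t"] that mb by (simp add: \<gamma>_def E_def abs_mult algebra_simps)
  qed (use am in simp)
  then have left: "\<bar>integral {a..m} (D 0) - (\<Sum>k<n. h ^ (k + 1) / fact (k + 1) * ((-1) ^ k * D k m))\<bar>
      \<le> h ^ (n + 1) / fact (n + 1) * (\<alpha> - \<beta> * h / (real n + 2)) powr (1 / q)"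
    using h(2) by (simp add: E0 Henstock_Kurzweil_Integration.integral_reflect_real) (simp add: E_def)

  have "continuous_on {a..b} (D 0)"
    using deriv[of 0] \<open>n \<ge> 1\<close> by (intro DERIV_continuous_on[of _ _ "D (Suc 0)"]) auto
  then have int: "integral {a..b} f = integral {a..m} (D 0) + integral {m..b} (D 0)"
    using Henstock_Kurzweil_Integration.integral_combine[of a m b "D 0"] am mb
    by (simp add: integrable_continuous_real D_def)
  \<comment> \<open>The powers of 2 are absorbed by b - a = 2 h; the summand 1 comes from the right
    half and (-1)^k from the left.\<close>
  have "(\<Sum>k<n. (1 + (-1) ^ k) / (2 ^ (k + 1) * fact (k + 1)) * (b - a) ^ (k + 1) * D k m)
      = (\<Sum>k<n. h ^ (k + 1) / fact (k + 1) * ((-1) ^ k * D k m))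
      + (\<Sum>k<n. h ^ (k + 1) / fact (k + 1) * D k m)"
    unfolding sum.distrib[symmetric] h(3)
    by (intro sum.cong refl) (simp add: power_mult_distrib distrib_left distrib_right add_divide_distrib mult_ac
        del: power_Suc fact_Suc)
  \<comment> \<open>Since \<beta> h is half of \<gamma> b - \<gamma> a, the endpoint weights are 1/2
    plus or minus 1 / (2 n + 4).\<close>
  moreover have "(real n + 1) / (2 * real n + 4) * \<gamma> a + (real n + 3) / (2 * real n + 4) * \<gamma> b
      = \<alpha> + \<beta> * h / (real n + 2)"
    and "(real n + 3) / (2 * real n + 4) * \<gamma> a + (real n + 1) / (2 * real n + 4) * \<gamma> b
      = \<alpha> - \<beta> * h / (real n + 2)"
    using \<open>h > 0\<close> by (simp_all add: \<alpha>_def \<beta>_def h(3) divide_simps) (simp_all add: algebra_simps)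
  moreover have "(b - a) ^ (n + 1) / (2 ^ (n + 1) * fact (n + 1)) = h ^ (n + 1) / fact (n + 1)"
    unfolding h(3) by (simp add: power_mult_distrib)
  ultimately show ?thesis
    unfolding D_def[symmetric] m_def[symmetric] \<gamma>_def[symmetric] int
    using left right by (simp only: distrib_left abs_le_iff) linarith
qed

end
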